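(* Assume $q_\alpha=0$ and the no-flow boundary condition (zero normal flux $\check M_{\alpha,1}\nabla_h(p_h^{k+1}+\mu_{\alpha,h}^{k+1})$ on boundary faces), $\alpha=w,n$. Let $S_{\alpha,h}^k,S_{\alpha,h}^{k+1}\in\mathcal C_h$ have values in $(0,1)$ with $S_{w,h}^j+S_{n,h}^j=1$ for $j=k,k+1$, and let $p_h^{k+1}\in\mathcal C_h$ be such that the first-order scheme holds: $$\phi_h\frac{S_{\alpha,h}^{k+1}-S_{\alpha,h}^k}{\Delta t}-\nabla_h\cdot\big(\check M_{\alpha,1}\nabla_h(p_h^{k+1}+\mu_{\alpha,h}^{k+1})\big)=0,\quad \alpha=w,n,$$ $$\mu_{w,h}^{k+1}=\sigma_w\ln(S_{w,h}^{k+1})+\sigma_{wn}S_{n,h}^k,\qquad \mu_{n,h}^{k+1}=\sigma_n\ln(S_{n,h}^{k+1})+\sigma_{wn}S_{w,h}^k.$$ Then the discrete original energy dissipation law holds: $$\frac{\mathcal E_{tol,h}^{k+1}-\mathcal E_{tol,h}^k}{\Delta t}\le-\sum_{\alpha=w,n}\Big\|(\check M_{\alpha,1})^{1/2}\,\nabla_h(p_h^{k+1}+\mu_{\alpha,h}^{k+1})\Big\|_h^2\le0 .$$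
   Context: Grid. $d\in\{2,3\}$; $\Omega=\prod_{l=1}^d[a_l,b_l]$ is divided uniformly into cubic cells of side $h$, with $N_l=(b_l-a_l)/h$ a positive integer. $\mathcal C_h$ is the space of real functions on the set of cell centers. For an interior face shared by two cells adjacent in direction $l$, $(\nabla_h c)$ on that face is $(c^+-c^-)/h$, where $c^\pm$ are the values of $c$ at the two adjacent cell centers ($+$ being the one with the larger $l$-th coordinate). For a real function $u$ on faces, $(\nabla_h\cdot u)$ at a cell is $\sum_{l=1}^d (u_{l,\text{upper}}-u_{l,\text{lower}})/h$, the sum over the two faces of the cell orthogonal to direction $l$; in $\nabla_h\cdot(M\nabla_h c)$ the flux is $0$ on every boundary face. Inner product: $(c,c')_h=h^d\sum_{\text{cells}}c\,c'$ on $\mathcal C_h$; for face functions, $\|u\|_h^2=h^d\sum_{\text{interior faces}}u^2$. Parameters. $\Delta t>0$, $m>0$, $K>0$, $\eta_w,\eta_n>0$, $\sigma_w,\sigma_n,\sigma_{wn}>0$ are real constants; $\phi_h\in\mathcal C_h$ is time-independent with $0<\phi_h<1$. $q_\alpha$ denotes the injection/production rate of phase $\alpha$ (zero here). Mobilities. On each interior face, $\check M_{\alpha,1}$ is the arithmetic mean of the values of $K(S_{\alpha,h}^k)^m/\eta_\alpha$ at the two adjacent cell centers. Discrete total energy: $\mathcal E_{tol,h}^k=(\phi_h,F(S_{w,h}^k,S_{n,h}^k))_h$ with $F(S_w,S_n)=\sum_{\alpha=w,n}\sigma_\alpha S_\alpha(\ln S_\alpha-1)+\sigma_{wn}S_wS_n$.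 *)

theory Defs
  imports "HOL-Analysis.Analysis"
begin

section \<open>Uniform cell-centred grid\<close>

text \<open>
  The spatial directions are the elements of the finite index type \<open>'d\<close>, so the dimension is
  \<open>CARD('d)\<close>. The domain is the box \<open>cbox a b\<close>.
\<close>

definition uniform_grid :: "real^'d \<Rightarrow> real^'d \<Rightarrow> real \<Rightarrow> bool" where
  "uniform_grid a b h \<longleftrightarrow>
     0 < h \<and> (\<forall>l. \<exists>N::nat. 0 < N \<and> (b $ l - a $ l) / h = real N)"

definition cell_centers :: "real^'d \<Rightarrow> real^'d \<Rightarrow> real \<Rightarrow> (real^'d) set" where
  "cell_centers a b h =
     {x. \<forall>l. \<exists>i::nat. real i < (b $ l - a $ l) / h \<and> x $ l = a $ l + (real i + 1/2) * h}"

text \<open>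
  A grid function is represented by a total function on \<open>real^'d\<close>; only its values at the cell
  centers are ever used.

  A face is represented by its normal direction and its midpoint. The centers of the two cells
  (one of which lies outside the domain for a boundary face) that it separates are at distance
  \<open>h/2\<close> from the midpoint.
\<close>

type_synonym 'd gridfun = "real^'d \<Rightarrow> real"
type_synonym 'd face = "'d \<times> (real^'d)"

definition lower_cell :: "real \<Rightarrow> 'd::finite face \<Rightarrow> real^'d" where
  "lower_cell h f = snd f - (h / 2) *\<^sub>R axis (fst f) 1"

definition upper_cell :: "real \<Rightarrow> 'd::finite face \<Rightarrow> real^'d" where
  "upper_cell h f = snd f + (h / 2) *\<^sub>R axis (fst f) 1"

definition lower_face :: "real \<Rightarrow> real^'d \<Rightarrow> 'd::finite \<Rightarrow> 'd face" where
  "lower_face h x l = (l, x - (h / 2) *\<^sub>R axis l 1)"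

definition upper_face :: "real \<Rightarrow> real^'d \<Rightarrow> 'd::finite \<Rightarrow> 'd face" where
  "upper_face h x l = (l, x + (h / 2) *\<^sub>R axis l 1)"

definition interior_faces :: "real^'d \<Rightarrow> real^'d \<Rightarrow> real \<Rightarrow> ('d::finite face) set" where
  "interior_faces a b h =
     {f. lower_cell h f \<in> cell_centers a b h \<and> upper_cell h f \<in> cell_centers a b h}"

lemma finite_cell_centers: "finite (cell_centers a b h)"
proof -
  define A where "A l = (\<lambda>i. a $ l + (real i + 1/2) * h) ` {i. real i < (b $ l - a $ l) / h}" for l
  have "finite {i::nat. real i < r}" for r :: real
    by (rule finite_subset[of _ "{..nat \<lceil>r\<rceil>}"]) (auto, linarith)
  then have "finite (A l)" for l
    unfolding A_def by (rule finite_imageI)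
  then have "finite (vec_lambda ` PiE UNIV A)"
    by (intro finite_imageI finite_PiE) simp_all
  moreover have "cell_centers a b h \<subseteq> vec_lambda ` PiE UNIV A"
  proof
    fix x assume "x \<in> cell_centers a b h"
    then have "x $ l \<in> A l" for l
      unfolding cell_centers_def A_def by blast
    then have "vec_nth x \<in> PiE UNIV A"
      by (simp add: PiE_UNIV_domain)
    then have "vec_lambda (vec_nth x) \<in> vec_lambda ` PiE UNIV A"
      by (rule imageI)
    then show "x \<in> vec_lambda ` PiE UNIV A"
      by simp
  qed
  ultimately show ?thesis
    using finite_subset by blast
qed


section \<open>Discrete operators, inner product and norm\<close>

definition grad_h :: "real \<Rightarrow> 'd::finite gridfun \<Rightarrow> 'd face \<Rightarrow> real" where
  "grad_h h c f = (c (upper_cell h f) - c (lower_cell h f)) / h"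

definition div_h :: "real \<Rightarrow> ('d::finite face \<Rightarrow> real) \<Rightarrow> 'd gridfun" where
  "div_h h u x = (\<Sum>l\<in>UNIV. (u (upper_face h x l) - u (lower_face h x l)) / h)"

definition face_mean :: "real \<Rightarrow> 'd::finite gridfun \<Rightarrow> 'd face \<Rightarrow> real" where
  "face_mean h c f = (c (lower_cell h f) + c (upper_cell h f)) / 2"

text \<open>The face flux of \<open>c\<close> with face coefficient \<open>M\<close>, with the no-flow boundary condition.\<close>

definition no_flow_flux ::
  "real^'d \<Rightarrow> real^'d \<Rightarrow> real \<Rightarrow> ('d::finite face \<Rightarrow> real) \<Rightarrow> 'd gridfun \<Rightarrow> 'd face \<Rightarrow> real" where
  "no_flow_flux a b h M c f = (if f \<in> interior_faces a b h then M f * grad_h h c f else 0)"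

definition inner_h :: "real^'d \<Rightarrow> real^'d \<Rightarrow> real \<Rightarrow> 'd::finite gridfun \<Rightarrow> 'd gridfun \<Rightarrow> real" where
  "inner_h a b h c c' = h ^ CARD('d) * (\<Sum>x\<in>cell_centers a b h. c x * c' x)"

definition face_norm_h :: "real^'d \<Rightarrow> real^'d \<Rightarrow> real \<Rightarrow> ('d::finite face \<Rightarrow> real) \<Rightarrow> real" where
  "face_norm_h a b h u = sqrt (h ^ CARD('d) * (\<Sum>f\<in>interior_faces a b h. (u f)\<^sup>2))"


section \<open>Two-phase flow\<close>

datatype phase = Wet | Nonwet

text \<open>The mobility on faces, built from the saturation \<open>S\<close> of one phase of viscosity \<open>\<eta>\<close>.\<close>

definition mobility :: "real \<Rightarrow> real \<Rightarrow> real \<Rightarrow> real \<Rightarrow> 'd::finite gridfun \<Rightarrow> 'd face \<Rightarrow> real" where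
  "mobility h K m \<eta> S = face_mean h (\<lambda>x. K * (S x powr m) / \<eta>)"

definition free_energy :: "(phase \<Rightarrow> real) \<Rightarrow> real \<Rightarrow> real \<Rightarrow> real \<Rightarrow> real" where
  "free_energy \<sigma> \<sigma>wn sw sn =
     \<sigma> Wet * sw * (ln sw - 1) + \<sigma> Nonwet * sn * (ln sn - 1) + \<sigma>wn * sw * sn"

definition total_energy ::
  "real^'d \<Rightarrow> real^'d \<Rightarrow> real \<Rightarrow> (phase \<Rightarrow> real) \<Rightarrow> real \<Rightarrow> 'd::finite gridfun
     \<Rightarrow> (phase \<Rightarrow> 'd gridfun) \<Rightarrow> real" where
  "total_energy a b h \<sigma> \<sigma>wn \<phi> S =
     inner_h a b h \<phi> (\<lambda>x. free_energy \<sigma> \<sigma>wn (S Wet x) (S Nonwet x))"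

end

theory Submission
  imports Defs
begin

text \<open>
  Testing the scheme for each phase with \<open>p + \<mu> \<alpha>\<close> and summing by parts produces the dissipation;
  the pressure drops out of the left-hand side because the two saturation increments cancel.
  It remains to see that \<open>\<mu>\<close> paired with the increments dominates the change of the free energy:
  the entropy terms are convex and treated implicitly, while the error in the explicit treatment of
  the bilinear term is minus the square of the increment, again because the increments cancel.
\<close>

text \<open>Inverse laws behind the change between sums over pairs of cell and direction and sums
  over faces; the half step that is added is exactly the one subtracted.\<close>

lemma upper_lower_face_simps [simp]:
  "lower_cell h (upper_face h x l) = x" "fst (upper_face h x l) = l"
  "upper_cell h (lower_face h x l) = x" "fst (lower_face h x l) = l"
  "upper_face h (lower_cell h f) (fst f) = f" "lower_face h (upper_cell h f) (fst f) = f"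
  by (simp_all add: upper_face_def lower_face_def upper_cell_def lower_cell_def)

text \<open>A face is the upper face of one cell only, its lower cell. So the interior faces match
  the pairs (x, l) whose upper face is interior, and at the other pairs \<open>u\<close>
  vanishes.\<close>

lemma sum_upper_faces:
  fixes c :: "'d::finite gridfun" and u :: "'d face \<Rightarrow> real"
  assumes "\<And>f. f \<notin> interior_faces a b h \<Longrightarrow> u f = 0"
  shows "(\<Sum>x\<in>cell_centers a b h. \<Sum>l\<in>UNIV. c x * u (upper_face h x l))
       = (\<Sum>f\<in>interior_faces a b h. c (lower_cell h f) * u f)"
proof -
  \<comment> \<open>\<open>S'\<close> holds the pairs with a boundary face, whose summands are zero;
    \<open>T'\<close> is empty because every interior face has its lower cell in the grid.\<close>
  have "(\<Sum>(x, l)\<in>cell_centers a b h \<times> UNIV. c x * u (upper_face h x l))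
      = (\<Sum>f\<in>interior_faces a b h. c (lower_cell h f) * u f)"
    by (rule sum.reindex_bij_witness_not_neutral[where j = "\<lambda>(x, l). upper_face h x l"
          and i = "\<lambda>f. (lower_cell h f, fst f)"
          and S' = "{z \<in> cell_centers a b h \<times> UNIV. upper_face h (fst z) (snd z) \<notin> interior_faces a b h}"
          and T' = "{}"])
      (auto simp: assms finite_cell_centers interior_faces_def)
  then show ?thesis by (simp add: sum.cartesian_product)
qed

text \<open>Mirror image of the previous count: a face is the lower face of its upper cell, so
  \<open>c\<close> is now sampled on the other side.\<close>

lemma sum_lower_faces:
  fixes c :: "'d::finite gridfun" and u :: "'d face \<Rightarrow> real"
  assumes "\<And>f. f \<notin> interior_faces a b h \<Longrightarrow> u f = 0"
  shows "(\<Sum>x\<in>cell_centers a b h. \<Sum>l\<in>UNIV. c x * u (lower_face h x l))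
       = (\<Sum>f\<in>interior_faces a b h. c (upper_cell h f) * u f)"
proof -
  have "(\<Sum>(x, l)\<in>cell_centers a b h \<times> UNIV. c x * u (lower_face h x l))
      = (\<Sum>f\<in>interior_faces a b h. c (upper_cell h f) * u f)"
    by (rule sum.reindex_bij_witness_not_neutral[where j = "\<lambda>(x, l). lower_face h x l"
          and i = "\<lambda>f. (upper_cell h f, fst f)"
          and S' = "{z \<in> cell_centers a b h \<times> UNIV. lower_face h (fst z) (snd z) \<notin> interior_faces a b h}"
          and T' = "{}"])
      (auto simp: assms finite_cell_centers interior_faces_def)
  then show ?thesis by (simp add: sum.cartesian_product)
qed

text \<open>The two cells at an interior face see its flux with opposite signs, so collecting terms
  by face leaves minus the jump of \<open>c\<close>. No boundary terms arise, since \<open>u\<close>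
  vanishes there.\<close>

lemma summation_by_parts:
  assumes "\<And>f. f \<notin> interior_faces a b h \<Longrightarrow> u f = 0"
  shows "(\<Sum>x\<in>cell_centers a b h. c x * div_h h u x)
       = - (\<Sum>f\<in>interior_faces a b h. grad_h h c f * u f)"
proof -
  have "(\<Sum>x\<in>cell_centers a b h. c x * div_h h u x)
      = ((\<Sum>x\<in>cell_centers a b h. \<Sum>l\<in>UNIV. c x * u (upper_face h x l))
        - (\<Sum>x\<in>cell_centers a b h. \<Sum>l\<in>UNIV. c x * u (lower_face h x l))) / h"
    by (simp add: div_h_def sum_distrib_left sum_subtractf sum_divide_distrib
        diff_divide_distrib right_diff_distrib)
  also have "\<dots> = ((\<Sum>f\<in>interior_faces a b h. c (lower_cell h f) * u f)
      - (\<Sum>f\<in>interior_faces a b h. c (upper_cell h f) * u f)) / h"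
    by (simp add: sum_upper_faces[of a b h u, OF assms] sum_lower_faces[of a b h u, OF assms])
  also have "\<dots> = - (\<Sum>f\<in>interior_faces a b h. grad_h h c f * u f)"
    by (simp add: grad_h_def sum_subtractf sum_divide_distrib diff_divide_distrib left_diff_distrib)
  finally show ?thesis .
qed

text \<open>Testing the divergence with the function that drives the flux gives a quadratic form
  with weight \<open>M\<close>; its sign allows the square root to be absorbed into the
  norm.\<close>

lemma sum_mult_div_no_flow_flux:
  fixes a b :: "real^'d" and c :: "'d gridfun"
  assumes "0 < h" and "\<And>f. f \<in> interior_faces a b h \<Longrightarrow> 0 \<le> M f"
  shows "h ^ CARD('d) * (\<Sum>x\<in>cell_centers a b h. c x * div_h h (no_flow_flux a b h M c) x)
       = - (face_norm_h a b h (\<lambda>f. sqrt (M f) * grad_h h c f))\<^sup>2"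
proof -
  have "(face_norm_h a b h (\<lambda>f. sqrt (M f) * grad_h h c f))\<^sup>2
      = h ^ CARD('d) * (\<Sum>f\<in>interior_faces a b h. (sqrt (M f) * grad_h h c f)\<^sup>2)"
    using assms(1) by (simp add: face_norm_h_def sum_nonneg)
  also have "\<dots> = h ^ CARD('d) * (\<Sum>f\<in>interior_faces a b h. grad_h h c f * no_flow_flux a b h M c f)"
    using assms(2)
    by (intro arg_cong2[where f = "(*)"] sum.cong)
      (simp_all add: no_flow_flux_def power_mult_distrib power2_eq_square[of "grad_h h c _"])
  finally show ?thesis
    by (simp add: summation_by_parts no_flow_flux_def)
qed

text \<open>Convexity: \<open>s * (ln s - 1)\<close> has derivative \<open>ln s\<close> and lies
  above its tangent at the new value \<open>t\<close>. This amounts to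
  \<open>ln r \<le> r - 1\<close> at \<open>r = t / s\<close>.\<close>

lemma entropy_tangent:
  fixes s t :: real
  assumes "0 < s" "0 < t"
  shows "t * (ln t - 1) - s * (ln s - 1) \<le> ln t * (t - s)"
proof -
  have "s * ln (t / s) \<le> s * (t / s - 1)"
    using assms by (intro mult_left_mono ln_le_minus_one) simp_all
  then show ?thesis
    using assms by (simp add: ln_div algebra_simps)
qed

text \<open>The factors of the increments are the chemical potentials of the scheme: logarithms at
  the new state \<open>t\<close>, interaction at the old state \<open>s\<close>.\<close>

lemma free_energy_diff_le:
  assumes "0 < sw" "0 < sn" "0 < tw" "0 < tn" and "sw + sn = 1" "tw + tn = 1"
    and "0 \<le> \<sigma> Wet" "0 \<le> \<sigma> Nonwet" "0 \<le> \<sigma>wn"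
  shows "free_energy \<sigma> \<sigma>wn tw tn - free_energy \<sigma> \<sigma>wn sw sn
      \<le> (\<sigma> Wet * ln tw + \<sigma>wn * sn) * (tw - sw) + (\<sigma> Nonwet * ln tn + \<sigma>wn * sw) * (tn - sn)"
proof -
  have w: "\<sigma> Wet * (tw * (ln tw - 1) - sw * (ln sw - 1)) \<le> \<sigma> Wet * (ln tw * (tw - sw))"
    and n: "\<sigma> Nonwet * (tn * (ln tn - 1) - sn * (ln sn - 1)) \<le> \<sigma> Nonwet * (ln tn * (tn - sn))"
    using assms by (auto intro!: mult_left_mono entropy_tangent)
  \<comment> \<open>Linearizing the product at the old state leaves exactly the product of the
    increments as remainder.\<close>
  have "tw * tn - sw * sn - sn * (tw - sw) - sw * (tn - sn) = (tw - sw) * (tn - sn)"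
    by (simp add: algebra_simps)
  also have "(tw - sw) * (tn - sn) = (tw - sw) * - (tw - sw)"
    using assms by (intro arg_cong2[where f = "(*)"]) simp_all
  also have "(tw - sw) * - (tw - sw) \<le> 0"
    by (simp only: mult_minus_right neg_le_0_iff_le zero_le_square)
  finally have "tw * tn - sw * sn - sn * (tw - sw) - sw * (tn - sn) \<le> 0"
    by simp
  then have "\<sigma>wn * (tw * tn - sw * sn - sn * (tw - sw) - sw * (tn - sn)) \<le> 0"
    using assms by (simp add: mult_nonneg_nonpos)
  with w n show ?thesis
    by (simp add: free_energy_def algebra_simps)
qed

text \<open>\<open>powr\<close> is nonnegative at every real base, which is why no range for
  \<open>S\<close> is assumed.\<close>

lemma mobility_nonneg:
  assumes "0 \<le> K" "0 \<le> \<eta>"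
  shows "0 \<le> mobility h K m \<eta> S f"
  using assms by (simp add: mobility_def face_mean_def)

theorem theorem4p2:
  fixes a b :: "real^'d"
    and h \<Delta>t m K \<sigma>wn :: real
    and \<eta> \<sigma> :: "phase \<Rightarrow> real"
    and \<phi> p :: "'d gridfun"
    and S0 S1 \<mu> :: "phase \<Rightarrow> 'd gridfun"
    and M :: "phase \<Rightarrow> 'd face \<Rightarrow> real"
  assumes dim: "CARD('d) = 2 \<or> CARD('d) = 3"
    and grid: "uniform_grid a b h"
    and params: "0 < \<Delta>t" "0 < m" "0 < K" "\<forall>\<alpha>. 0 < \<eta> \<alpha>" "\<forall>\<alpha>. 0 < \<sigma> \<alpha>" "0 < \<sigma>wn"
    and porosity: "\<forall>x\<in>cell_centers a b h. 0 < \<phi> x \<and> \<phi> x < 1"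
    and S0_range: "\<forall>\<alpha>. \<forall>x\<in>cell_centers a b h. 0 < S0 \<alpha> x \<and> S0 \<alpha> x < 1"
    and S1_range: "\<forall>\<alpha>. \<forall>x\<in>cell_centers a b h. 0 < S1 \<alpha> x \<and> S1 \<alpha> x < 1"
    and S0_sum: "\<forall>x\<in>cell_centers a b h. S0 Wet x + S0 Nonwet x = 1"
    and S1_sum: "\<forall>x\<in>cell_centers a b h. S1 Wet x + S1 Nonwet x = 1"
    and M: "\<forall>\<alpha>. \<forall>f\<in>interior_faces a b h. M \<alpha> f = mobility h K m (\<eta> \<alpha>) (S0 \<alpha>) f"
    and mu_w: "\<forall>x\<in>cell_centers a b h. \<mu> Wet x = \<sigma> Wet * ln (S1 Wet x) + \<sigma>wn * S0 Nonwet x"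
    and mu_n: "\<forall>x\<in>cell_centers a b h. \<mu> Nonwet x = \<sigma> Nonwet * ln (S1 Nonwet x) + \<sigma>wn * S0 Wet x"
    and scheme: "\<forall>\<alpha>. \<forall>x\<in>cell_centers a b h.
      \<phi> x * ((S1 \<alpha> x - S0 \<alpha> x) / \<Delta>t)
        - div_h h (no_flow_flux a b h (M \<alpha>) (\<lambda>y. p y + \<mu> \<alpha> y)) x = 0"
  shows "(total_energy a b h \<sigma> \<sigma>wn \<phi> S1 - total_energy a b h \<sigma> \<sigma>wn \<phi> S0) / \<Delta>t
      \<le> - (\<Sum>\<alpha>\<in>{Wet, Nonwet}.
            (face_norm_h a b h (\<lambda>f. sqrt (M \<alpha> f) * grad_h h (\<lambda>y. p y + \<mu> \<alpha> y) f))\<^sup>2)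
    \<and> - (\<Sum>\<alpha>\<in>{Wet, Nonwet}.
            (face_norm_h a b h (\<lambda>f. sqrt (M \<alpha> f) * grad_h h (\<lambda>y. p y + \<mu> \<alpha> y) f))\<^sup>2) \<le> 0"
proof -
  let ?C = "cell_centers a b h"
  let ?D = "\<lambda>\<alpha>. (face_norm_h a b h (\<lambda>f. sqrt (M \<alpha> f) * grad_h h (\<lambda>y. p y + \<mu> \<alpha> y) f))\<^sup>2"
  let ?flux = "\<lambda>\<alpha>. no_flow_flux a b h (M \<alpha>) (\<lambda>y. p y + \<mu> \<alpha> y)"
  have h: "0 < h"
    using grid by (simp add: uniform_grid_def)
  have "0 \<le> M \<alpha> f" if "f \<in> interior_faces a b h" for \<alpha> f
    using that M params by (simp add: mobility_nonneg less_imp_le)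
  then have dissipation:
    "h ^ CARD('d) * (\<Sum>x\<in>?C. (p x + \<mu> \<alpha> x) * div_h h (?flux \<alpha>) x) = - ?D \<alpha>" for \<alpha>
    using sum_mult_div_no_flow_flux[OF h, of a b "M \<alpha>" "\<lambda>y. p y + \<mu> \<alpha> y"] by blast
  let ?F = "\<lambda>S x. free_energy \<sigma> \<sigma>wn (S Wet x) (S Nonwet x)"
  \<comment> \<open>The energy estimate already holds cell by cell; summation is needed only to turn
    the divergences into dissipation.\<close>
  have cell: "\<phi> x * (?F S1 x - ?F S0 x)
      \<le> \<Delta>t * ((p x + \<mu> Wet x) * div_h h (?flux Wet) x
             + (p x + \<mu> Nonwet x) * div_h h (?flux Nonwet) x)" if x: "x \<in> ?C" for x
  proof -
    have flux: "\<phi> x * (S1 \<alpha> x - S0 \<alpha> x) = \<Delta>t * div_h h (?flux \<alpha>) x" for \<alpha>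
    proof -
      have "\<phi> x * ((S1 \<alpha> x - S0 \<alpha> x) / \<Delta>t) = div_h h (?flux \<alpha>) x"
        using scheme x by simp
      then show ?thesis
        using params(1) by (simp add: field_simps)
    qed
    have cancel: "S1 Nonwet x - S0 Nonwet x = - (S1 Wet x - S0 Wet x)"
      using S0_sum S1_sum x by fastforce
    have "?F S1 x - ?F S0 x
        \<le> \<mu> Wet x * (S1 Wet x - S0 Wet x) + \<mu> Nonwet x * (S1 Nonwet x - S0 Nonwet x)"
      using free_energy_diff_le[of "S0 Wet x" "S0 Nonwet x" "S1 Wet x" "S1 Nonwet x" \<sigma> \<sigma>wn]
        S0_range S1_range S0_sum S1_sum mu_w mu_n params x by (simp add: less_imp_le)
    \<comment> \<open>The pressure enters for free: by \<open>cancel\<close> it multiplies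
      increments that add up to zero.\<close>
    also have "\<dots> = (p x + \<mu> Wet x) * (S1 Wet x - S0 Wet x)
        + (p x + \<mu> Nonwet x) * (S1 Nonwet x - S0 Nonwet x)"
      unfolding cancel by (simp add: algebra_simps)
    \<comment> \<open>The weight \<open>\<phi> x\<close> is positive, and with it each increment
      becomes \<open>\<Delta>t\<close> times a flux divergence by the scheme.\<close>
    finally have "\<phi> x * (?F S1 x - ?F S0 x)
        \<le> \<phi> x * ((p x + \<mu> Wet x) * (S1 Wet x - S0 Wet x)
                 + (p x + \<mu> Nonwet x) * (S1 Nonwet x - S0 Nonwet x))"
      using porosity x by (intro mult_left_mono) (simp_all add: less_imp_le)
    also have "\<dots> = (p x + \<mu> Wet x) * (\<phi> x * (S1 Wet x - S0 Wet x))
        + (p x + \<mu> Nonwet x) * (\<phi> x * (S1 Nonwet x - S0 Nonwet x))"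
      by (simp only: distrib_left mult.left_commute)
    finally show ?thesis
      unfolding flux by (simp only: distrib_left mult.left_commute)
  qed
  have "total_energy a b h \<sigma> \<sigma>wn \<phi> S1 - total_energy a b h \<sigma> \<sigma>wn \<phi> S0
      = h ^ CARD('d) * (\<Sum>x\<in>?C. \<phi> x * (?F S1 x - ?F S0 x))"
    by (simp add: total_energy_def inner_h_def right_diff_distrib sum_subtractf)
  also have "\<dots> \<le> h ^ CARD('d) * (\<Sum>x\<in>?C. \<Delta>t * ((p x + \<mu> Wet x) * div_h h (?flux Wet) x
             + (p x + \<mu> Nonwet x) * div_h h (?flux Nonwet) x))"
    using h cell by (intro mult_left_mono sum_mono) simp_all
  also have "\<dots> = \<Delta>t * (h ^ CARD('d) * (\<Sum>x\<in>?C. (p x + \<mu> Wet x) * div_h h (?flux Wet) x)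
      + h ^ CARD('d) * (\<Sum>x\<in>?C. (p x + \<mu> Nonwet x) * div_h h (?flux Nonwet) x))"
    by (simp only: sum_distrib_left[symmetric] sum.distrib distrib_left mult.left_commute)
  also have "\<dots> = \<Delta>t * - (\<Sum>\<alpha>\<in>{Wet, Nonwet}. ?D \<alpha>)"
    unfolding dissipation by simp
  finally have "(total_energy a b h \<sigma> \<sigma>wn \<phi> S1 - total_energy a b h \<sigma> \<sigma>wn \<phi> S0) / \<Delta>t
      \<le> - (\<Sum>\<alpha>\<in>{Wet, Nonwet}. ?D \<alpha>)"
    using params(1) by (simp only: pos_divide_le_eq mult.commute)
  moreover have "- (\<Sum>\<alpha>\<in>{Wet, Nonwet}. ?D \<alpha>) \<le> 0"
    by (simp add: sum_nonneg)
  ultimately show ?thesis ..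
qed

end
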